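(* Assume $\mathcal{D}\cap\mathcal{T}=\emptyset$, $\mathcal{D}\cap\mathcal{B}=\emptyset$ and $\mathcal{T}\cap\mathcal{C}=\emptyset$. Let $\mathcal{P}_1,\dots,\mathcal{P}_\ell$ be all possible $\mathcal{D}$-to-$\mathcal{T}$ paths. The following two conditions on the input node set $\mathcal{B}$ are equivalent, and if either of them holds then the DDPSF is solvable for the system $\dot x=Ax+Bu+Dw$, $y=Cx$, $z=Tx$: (a) $\mathcal{D}\subseteq\mathcal{Z}^\circ(\mathcal{B})$; (b) $\mathcal{B}\cap\mathcal{P}_j\neq\emptyset$ for all $j\in\{1,\dots,\ell\}$.
   Context: Let $(\mathcal{V},\mathcal{E},A)$ be a digraph with node set $\mathcal{V}=\{v_1,\dots,v_n\}$, edge set $\mathcal{E}$, where $(v_i,v_j)\in\mathcal{E}$ means $v_i\to v_j$, and weighted adjacency matrix $A\in\mathbb{R}^{n\times n}$ with $A_{ji}\neq0$ if and only if $(v_i,v_j)\in\mathcal{E}$. Let $\mathcal{B},\mathcal{C},\mathcal{D},\mathcal{T}\subseteq\mathcal{V}$ be the sets of input, output, disturbance and target nodes. The columns of $B\in\mathbb{R}^{n\times|\mathcal{B}|}$ are the canonical vectors $e_i$ with $v_i\in\mathcal{B}$; the columns of $D\in\mathbb{R}^{n\times|\mathcal{D}|}$ are the $e_i$ with $v_i\in\mathcal{D}$; the rows of $C\in\mathbb{R}^{|\mathcal{C}|\times n}$ are the $e_i^\top$ with $v_i\in\mathcal{C}$; the rows of $T\in\mathbb{R}^{|\mathcal{T}|\times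 n}$ are the $e_i^\top$ with $v_i\in\mathcal{T}$. The DDPSF (disturbance decoupling problem by state feedback, $u=-Fx$) is solvable if there exists $F\in\mathbb{R}^{|\mathcal{B}|\times n}$ such that $T(sI-A+BF)^{-1}D=0$ for all $s$ (as a rational matrix identity). $\mathcal{Z}^\circ(\mathcal{B})$ is the limit of the recursion $\mathcal{Z}_0=\mathcal{V}\setminus\mathcal{T}$, $\mathcal{Z}_{k+1}=\mathcal{Z}_k\setminus\{v_i\in\mathcal{Z}_k:\exists\,(v_i,v_j)\in\mathcal{E}\text{ with }v_j\notin\mathcal{Z}_k\cup\mathcal{B}\}$, which becomes stationary in finitely many steps; it is the maximal subset $\mathcal{Z}$ of $\mathcal{V}\setminus\mathcal{T}$ such that every edge starting in $\mathcal{Z}$ ends in $\mathcal{Z}\cup\mathcal{B}$. A $\mathcal{D}$-to-$\mathcal{T}$ path is a sequence of distinct nodes, the first in $\mathcal{D}$ and the last in $\mathcal{T}$, in which each consecutive pair is an edge; it is also regarded as the set of its nodes. *)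

theory Defs
  imports
    "Graph_Theory.Graph_Theory"
    "HOL-Computational_Algebra.Polynomial_Factorial"
    "Jordan_Normal_Form.Gauss_Jordan_Elimination"
begin

text \<open>
  The node $v_{i+1}$ is represented by the index \<open>i\<close>, so that nodes directly index the rows and
  columns of matrices. The arc \<open>(i, j)\<close> is weighted by the entry \<open>A $$ (j, i)\<close>, as is usual for
  $\dot x = A x$. Self-loops are allowed.
\<close>
locale weighted_digraph = pair_wf_digraph G for G :: "nat pair_pre_digraph" +
  fixes n :: nat and A :: "real mat"
  assumes verts_eq: "pverts G = {..<n}"
    and A_carrier: "A \<in> carrier_mat n n"
    and A_nonzero_iff: "\<And>i j. i < n \<Longrightarrow> j < n \<Longrightarrow> A $$ (j, i) \<noteq> 0 \<longleftrightarrow> (i, j) \<in> parcs G"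

text \<open>Canonical vectors of the nodes of a set, as columns resp. rows, in increasing order of the
  nodes.\<close>
definition sel_cols :: "nat \<Rightarrow> nat set \<Rightarrow> real mat" where
  "sel_cols n S = mat_of_cols n (map (unit_vec n) (sorted_list_of_set S))"

definition sel_rows :: "nat \<Rightarrow> nat set \<Rightarrow> real mat" where
  "sel_rows n S = mat_of_rows n (map (unit_vec n) (sorted_list_of_set S))"


text \<open>Rational functions in \<open>s\<close> are the elements of the fraction field of \<open>real poly\<close>.\<close>
definition rat_s :: "real poly fract" where
  "rat_s = to_fract [:0, 1:]"

definition rat_mat :: "real mat \<Rightarrow> real poly fract mat" where
  "rat_mat M = map_mat (\<lambda>c. to_fract [:c:]) M"

definition DDPSF_solvable :: "real mat \<Rightarrow> real mat \<Rightarrow> real mat \<Rightarrow> real mat \<Rightarrow> bool" where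
  "DDPSF_solvable A B D T \<longleftrightarrow>
     (\<exists>F \<in> carrier_mat (dim_col B) (dim_row A).
      \<exists>R. mat_inverse (rat_s \<cdot>\<^sub>m 1\<^sub>m (dim_row A) - rat_mat A + rat_mat B * rat_mat F) = Some R \<and>
          rat_mat T * R * rat_mat D = 0\<^sub>m (dim_row T) (dim_col D))"


fun Z_seq :: "nat pair_pre_digraph \<Rightarrow> nat set \<Rightarrow> nat set \<Rightarrow> nat \<Rightarrow> nat set" where
  "Z_seq G T B 0 = pverts G - T"
| "Z_seq G T B (Suc k) = Z_seq G T B k -
     {v \<in> Z_seq G T B k. \<exists>w. (v, w) \<in> parcs G \<and> w \<notin> Z_seq G T B k \<union> B}"

definition Z_lim :: "nat pair_pre_digraph \<Rightarrow> nat set \<Rightarrow> nat set \<Rightarrow> nat set" where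
  "Z_lim G T B = (THE Z. \<forall>\<^sub>F k in sequentially. Z_seq G T B k = Z)"

lemma Z_seq_antimono: "k \<le> m \<Longrightarrow> Z_seq G T B m \<subseteq> Z_seq G T B k"
  by (rule lift_Suc_antimono_le[of "Z_seq G T B"]) (simp_all only: Z_seq.simps Diff_subset)

lemma Z_seq_eventually_Z_lim:
  assumes "finite (pverts G)"
  shows "\<forall>\<^sub>F k in sequentially. Z_seq G T B k = Z_lim G T B"
proof -
  have fin: "finite (Z_seq G T B k)" for k
    by (rule finite_subset[OF Z_seq_antimono[of 0 k]]) (use assms in simp_all)
  define N where "N = (ARG_MIN (\<lambda>k. card (Z_seq G T B k)) k. True)"
  have "card (Z_seq G T B N) \<le> card (Z_seq G T B k)" for k
    unfolding N_def by (rule arg_min_nat_le) simp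
  then have "Z_seq G T B k = Z_seq G T B N" if "N \<le> k" for k
    by (rule card_seteq[OF fin Z_seq_antimono[OF that]])
  then have ev: "\<forall>\<^sub>F k in sequentially. Z_seq G T B k = Z_seq G T B N"
    unfolding eventually_sequentially by blast
  show ?thesis
    unfolding Z_lim_def
  proof (rule theI)
    show "Z = Z_seq G T B N" if "\<forall>\<^sub>F k in sequentially. Z_seq G T B k = Z" for Z
      using eventually_happens[OF eventually_conj[OF ev that]] by (metis sequentially_bot)
  qed (rule ev)
qed


definition DT_path :: "nat pair_pre_digraph \<Rightarrow> nat set \<Rightarrow> nat set \<Rightarrow> nat list \<Rightarrow> bool" where
  "DT_path G D T p \<longleftrightarrow> vpath p (with_proj G) \<and> hd p \<in> D \<and> last p \<in> T"

end

theory Submission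
  imports Defs "Jordan_Normal_Form.Char_Poly"
begin

text \<open>
  The limit set \<open>Z\<close> of the recursion is the largest set of non-target nodes whose outgoing arcs all
  end in \<open>Z \<union> B\<close> (\<open>Z_lim_subset\<close>, \<open>Z_lim_closed\<close>, \<open>Z_lim_greatest\<close>). With this description the
  equivalence is a matter of reachability. A path that starts in \<open>Z\<close> and ends in a target must leave
  \<open>Z\<close>, and the first node outside \<open>Z\<close> can only be an input node (\<open>vwalk_leaving_meets_exit\<close>).
  Conversely, if every disturbance-to-target path meets \<open>B\<close>, then the nodes reachable from \<open>D\<close>
  without touching \<open>B\<close> include no target, and an arc from such a node leads to one again or into
  \<open>B\<close>; so they all lie in the largest such set, and \<open>D\<close> is among them (\<open>sources_in_Z_lim\<close>).

  For solvability, let the feedback matrix consist of the rows of \<open>A\<close> that belong to the input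
  nodes. The closed loop matrix \<open>A - B F\<close> is then \<open>A\<close> with these rows replaced by zero: all arcs
  into \<open>B\<close> are deleted, and no arc is left that leads out of \<open>Z\<close>. The vectors supported on
  \<open>Z\<close> thus form an invariant subspace, which contains the image of \<open>D\<close> and lies in the kernel
  of \<open>T\<close>. The resolvent preserves this subspace as well
  (\<open>resolvent_preserves_invariant_coordinates\<close>), and so the transfer matrix vanishes. Invertibility
  of \<open>s I - N\<close> for a real matrix \<open>N\<close> holds because its determinant is a monic polynomial
  (\<open>det_pencil_nonzero\<close>); the fact is needed both for the closed loop itself and for its diagonal
  block outside \<open>Z\<close>.
\<close>

section \<open>The limit set and disturbance-to-target paths\<close>

text \<open>
  Having the limit as two consecutive members of the sequence makes it a fixed point of the
  recursion step, which is how closedness is read off.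
\<close>
lemma Z_lim_eq_Z_seq:
  assumes "finite (pverts G)"
  obtains k where "Z_lim G T B = Z_seq G T B k" "Z_lim G T B = Z_seq G T B (Suc k)"
proof -
  obtain k where "\<forall>m\<ge>k. Z_seq G T B m = Z_lim G T B"
    using Z_seq_eventually_Z_lim[OF assms, of T B] unfolding eventually_sequentially by blast
  then have "Z_lim G T B = Z_seq G T B k" "Z_lim G T B = Z_seq G T B (Suc k)"
    by (metis order_refl, metis le_SucI order_refl)
  then show ?thesis ..
qed

lemma Z_lim_subset:
  assumes "finite (pverts G)"
  shows "Z_lim G T B \<subseteq> pverts G - T"
proof -
  obtain k where "Z_lim G T B = Z_seq G T B k"
    using Z_lim_eq_Z_seq[OF assms] .
  then show ?thesis using Z_seq_antimono[of 0 k G T B] by simp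
qed

lemma Z_lim_closed:
  assumes "finite (pverts G)" "v \<in> Z_lim G T B" "(v, w) \<in> parcs G"
  shows "w \<in> Z_lim G T B \<union> B"
proof -
  obtain k where k: "Z_lim G T B = Z_seq G T B k" "Z_lim G T B = Z_seq G T B (Suc k)"
    using Z_lim_eq_Z_seq[OF assms(1)] .
  then show ?thesis using assms(2,3) by auto
qed

lemma Z_lim_greatest:
  assumes "finite (pverts G)" "W \<subseteq> pverts G - T"
    and closed: "\<And>v w. v \<in> W \<Longrightarrow> (v, w) \<in> parcs G \<Longrightarrow> w \<in> W \<union> B"
  shows "W \<subseteq> Z_lim G T B"
proof -
  have "W \<subseteq> Z_seq G T B k" for k
  proof (induction k)
    case 0
    show ?case using assms(2) by simp
  next
    case (Suc k)
    then show ?case by (auto dest: closed)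
  qed
  moreover obtain k where "Z_lim G T B = Z_seq G T B k"
    using Z_lim_eq_Z_seq[OF assms(1)] .
  ultimately show ?thesis by simp
qed

lemma vwalk_leaving_meets_exit:
  assumes "vwalk p (with_proj G)" "hd p \<in> Z" "last p \<notin> Z"
    and "\<And>v w. v \<in> Z \<Longrightarrow> (v, w) \<in> parcs G \<Longrightarrow> w \<in> Z \<union> B"
  shows "B \<inter> set p \<noteq> {}"
  using assms(1,2,3)
proof (induction p rule: vwalk_induct)
  case (Cons u v es)
  then show ?case using assms(4)[of u v] by (cases "v \<in> Z") simp_all
qed simp

text \<open>
  For the converse direction, the set of nodes that walks from \<open>D\<close> reach without touching
  \<open>B\<close> is a competitor for the maximal set. Walks are used in its definition because they can be
  extended freely; a walk that ends in \<open>T\<close> is shortened to a path only once, and shortening cannot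
  create a new meeting with \<open>B\<close>.
\<close>
lemma sources_in_Z_lim:
  assumes fin: "finite (pverts G)" and wf: "parcs G \<subseteq> pverts G \<times> pverts G"
    and D: "D \<subseteq> pverts G" "D \<inter> B = {}"
    and meets: "\<And>p. DT_path G D T p \<Longrightarrow> B \<inter> set p \<noteq> {}"
  shows "D \<subseteq> Z_lim G T B"
proof -
  \<comment> \<open>The trivial walk at a source is allowed, and it avoids \<open>B\<close> because sources are not inputs.\<close>
  define W where
    "W = {last p | p. vwalk p (with_proj G) \<and> hd p \<in> D \<and> B \<inter> set p = {}}"
  have W_I: "last p \<in> W" if "vwalk p (with_proj G)" "hd p \<in> D" "B \<inter> set p = {}" for p
    unfolding W_def using that by blast
  have "W \<subseteq> pverts G - T"
  proof
    fix v assume "v \<in> W"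
    then obtain p where p: "vwalk p (with_proj G)" "hd p \<in> D" "B \<inter> set p = {}" "last p = v"
      unfolding W_def by auto
    have "v \<notin> T"
    proof
      assume "v \<in> T"
      then have "DT_path G D T (vwalk_to_vpath p)"
        using p by (simp add: DT_path_def vwalk_to_vpath_vpath vwalk_to_vpath_hd
            vwalk_to_vpath_last)
      then have "B \<inter> set (vwalk_to_vpath p) \<noteq> {}" by (rule meets)
      then show False using p(3) vwalk_to_vpath_subset[of _ p] by blast
    qed
    moreover have "v \<in> pverts G"
      using p(1,4) last_in_set[of p] by (auto simp: vwalk_def)
    ultimately show "v \<in> pverts G - T" by simp
  qed
  moreover have "w \<in> W \<union> B" if vw: "v \<in> W" "(v, w) \<in> parcs G" for v w
  proof (cases "w \<in> B")
    case False
    obtain p where p: "vwalk p (with_proj G)" "hd p \<in> D" "B \<inter> set p = {}" "last p = v"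
      using vw(1) unfolding W_def by auto
    have "p \<noteq> []" using p(1) by (simp add: vwalk_def)
    moreover have "w \<in> pverts G" using vw(2) wf by blast
    ultimately have "vwalk (p @ [w]) (with_proj G)"
      using p(1,4) vw(2) by (simp add: vwalk_def set_vwalk_arcs_snoc)
    moreover have "hd (p @ [w]) \<in> D" "B \<inter> set (p @ [w]) = {}"
      using p(2,3) \<open>p \<noteq> []\<close> False by simp_all
    ultimately have "last (p @ [w]) \<in> W" by (rule W_I)
    then show ?thesis by simp
  qed simp
  ultimately have "W \<subseteq> Z_lim G T B" by (rule Z_lim_greatest[OF fin])
  moreover have "d \<in> W" if "d \<in> D" for d
  proof -
    have "vwalk [d] (with_proj G)" "B \<inter> set [d] = {}" using D that by (auto simp: vwalk_def)
    then show ?thesis using W_I[of "[d]"] that by simp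
  qed
  ultimately show ?thesis by blast
qed

section \<open>Resolvents over the rational functions\<close>

lemma mult_mat_index_sum:
  assumes "X \<in> carrier_mat m n" "Y \<in> carrier_mat n k" "i < m" "j < k"
  shows "(X * Y) $$ (i, j) = (\<Sum>l<n. X $$ (i, l) * Y $$ (l, j))"
  using assms by (auto simp: scalar_prod_def lessThan_atLeast0 intro!: sum.cong)

definition pencil :: "real mat \<Rightarrow> real poly fract mat" where
  "pencil N = rat_s \<cdot>\<^sub>m 1\<^sub>m (dim_row N) - rat_mat N"

lemma pencil_carrier: "N \<in> carrier_mat n n \<Longrightarrow> pencil N \<in> carrier_mat n n"
  unfolding pencil_def rat_mat_def by auto

lemma pencil_index:
  assumes "N \<in> carrier_mat n n" "j < n" "k < n"
  shows "pencil N $$ (j, k) = (if j = k then rat_s else 0) - to_fract [:N $$ (j, k):]"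
  using assms by (simp add: pencil_def rat_mat_def)

lemma pencil_diff:
  assumes "A \<in> carrier_mat n n" "K \<in> carrier_mat n n"
  shows "pencil (A - K) = rat_s \<cdot>\<^sub>m 1\<^sub>m n - rat_mat A + rat_mat K"
  unfolding pencil_def
  by (rule eq_matI)
     (use assms in \<open>auto simp: rat_mat_def
        simp flip: to_fract_uminus to_fract_diff to_fract_add\<close>)

text \<open>
  The pencil is the image of the characteristic matrix under the embedding of the polynomials into
  their fraction field, so its determinant is the characteristic polynomial, which is monic.
\<close>
lemma det_pencil_nonzero:
  assumes N: "N \<in> carrier_mat n n"
  shows "det (pencil N) \<noteq> 0"
proof -
  interpret to_fract: comm_ring_hom "to_fract :: real poly \<Rightarrow> real poly fract"
    by unfold_locales simp_all
  have "pencil N = map_mat to_fract (char_poly_matrix N)"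
    by (rule eq_matI)
       (use N in \<open>auto simp: pencil_def rat_mat_def char_poly_matrix_def rat_s_def
          simp flip: to_fract_uminus to_fract_diff to_fract_add\<close>)
  then have "det (pencil N) = to_fract (char_poly N)"
    by (simp add: char_poly_def)
  moreover have "char_poly N \<noteq> 0"
    using degree_monic_char_poly[OF N] by (metis coeff_0 zero_neq_one)
  ultimately show ?thesis by simp
qed

lemma mat_inverse_pencil:
  assumes N: "N \<in> carrier_mat n n"
  obtains R where "mat_inverse (pencil N) = Some R" "R \<in> carrier_mat n n"
    "pencil N * R = 1\<^sub>m n"
proof (cases "mat_inverse (pencil N)")
  case None
  then show ?thesis
    using mat_inverse(1)[OF pencil_carrier[OF N], where b = "()"]
      det_non_zero_imp_unit[OF pencil_carrier[OF N] det_pencil_nonzero[OF N], where b = "()"]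
    by blast
next
  case (Some R)
  then show ?thesis using mat_inverse(2)[OF pencil_carrier[OF N] Some] that by blast
qed

text \<open>
  For \<open>i\<close> in \<open>Z\<close>, column \<open>i\<close> of \<open>R\<close> solves the pencil equation with right-hand side
  \<open>e\<^sub>i\<close>, which vanishes outside \<open>Z\<close>. Since \<open>N\<close> has no nonzero entries leading from \<open>Z\<close> to its
  complement, the part of that column outside \<open>Z\<close> solves a homogeneous equation by itself, namely
  the one for the diagonal block of \<open>N\<close> outside \<open>Z\<close>. The pencil of that block is regular too, so
  this part is zero: the resolvent maps vectors supported on \<open>Z\<close> to such vectors.
\<close>
lemma resolvent_preserves_invariant_coordinates:
  assumes N: "N \<in> carrier_mat n n" and R: "R \<in> carrier_mat n n"
    and inv: "pencil N * R = 1\<^sub>m n"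
    and Z: "\<And>i j. i < n \<Longrightarrow> j < n \<Longrightarrow> i \<in> Z \<Longrightarrow> j \<notin> Z \<Longrightarrow> N $$ (j, i) = 0"
    and ij: "i < n" "j < n" "i \<in> Z" "j \<notin> Z"
  shows "R $$ (j, i) = 0"
proof -
  \<comment> \<open>The outside block is padded with zeros to size \<open>n\<close>; on the padding the pencil is \<open>s\<close> times
    the identity, so it stays regular without any renumbering of nodes.\<close>
  define N' where "N' = mat n n (\<lambda>(j, k). if j \<in> Z \<or> k \<in> Z then 0 else N $$ (j, k))"
  define v where "v = vec n (\<lambda>k. if k \<in> Z then 0 else R $$ (k, i))"
  have N': "N' \<in> carrier_mat n n" and v: "v \<in> carrier_vec n"
    by (simp_all add: N'_def v_def)
  have N'_index: "N' $$ (j, k) = (if j \<in> Z \<or> k \<in> Z then 0 else N $$ (j, k))"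
    if "j < n" "k < n" for j k
    using that by (simp add: N'_def)
  have "pencil N' *\<^sub>v v = 0\<^sub>v n"
  proof (rule eq_vecI)
    fix l assume "l < dim_vec (0\<^sub>v n :: real poly fract vec)"
    then have l: "l < n" by simp
    have "(pencil N' *\<^sub>v v) $ l = (\<Sum>k<n. pencil N' $$ (l, k) * v $ k)"
      using pencil_carrier[OF N'] v l
      by (auto simp: scalar_prod_def lessThan_atLeast0 intro!: sum.cong)
    also have "\<dots> = 0"
    proof (cases "l \<in> Z")
      case True
      then show ?thesis
        by (intro sum.neutral) (auto simp: pencil_index[OF N' l] v_def N'_index l)
    next
      case False
      have "(\<Sum>k<n. pencil N' $$ (l, k) * v $ k) = (\<Sum>k<n. pencil N $$ (l, k) * R $$ (k, i))"
        using False l by (intro sum.cong)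
          (auto simp: pencil_index[OF N' l] pencil_index[OF N l] v_def N'_index Z)
      also have "\<dots> = (pencil N * R) $$ (l, i)"
        using mult_mat_index_sum[OF pencil_carrier[OF N] R l ij(1)] by simp
      also have "\<dots> = 0" using False ij l by (auto simp: inv)
      finally show ?thesis .
    qed
    finally show "(pencil N' *\<^sub>v v) $ l = 0\<^sub>v n $ l" using l by simp
  qed (use pencil_carrier[OF N'] in auto)
  then have "v = 0\<^sub>v n"
    using det_0_iff_vec_prod_zero_field[OF pencil_carrier[OF N']] det_pencil_nonzero[OF N'] v
    by blast
  then have "v $ j = 0" using ij by simp
  then show ?thesis using ij by (simp add: v_def)
qed

section \<open>Selection matrices and the decoupling feedback\<close>

lemma sel_cols_carrier: "sel_cols n S \<in> carrier_mat n (card S)"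
  using mat_of_cols_carrier(1)[of n "map (unit_vec n) (sorted_list_of_set S)"]
  by (simp add: sel_cols_def)

lemma sel_rows_carrier: "sel_rows n S \<in> carrier_mat (card S) n"
  using mat_of_rows_carrier(1)[of n "map (unit_vec n) (sorted_list_of_set S)"]
  by (simp add: sel_rows_def)

lemma sel_cols_index:
  assumes "i < n" "l < card S"
  shows "sel_cols n S $$ (i, l) = (if i = sorted_list_of_set S ! l then 1 else 0)"
  using assms by (simp add: sel_cols_def mat_of_cols_index unit_vec_def)

lemma sel_rows_index:
  assumes "i < n" "l < card S"
  shows "sel_rows n S $$ (l, i) = (if i = sorted_list_of_set S ! l then 1 else 0)"
  using assms by (simp add: sel_rows_def mat_of_rows_index unit_vec_def)

lemma rat_mat_mult:
  assumes "X \<in> carrier_mat a b" "Y \<in> carrier_mat b c"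
  shows "rat_mat (X * Y) = rat_mat X * rat_mat Y"
proof -
  have one: "to_fract [:1 :: real:] = 1"
    by (metis one_pCons to_fract_1)
  have add: "to_fract [:x + y :: real:] = to_fract [:x:] + to_fract [:y:]"
    and mult: "to_fract [:x * y :: real:] = to_fract [:x:] * to_fract [:y:]" for x y
    by (simp_all flip: to_fract_add to_fract_mult)
  interpret semiring_hom "\<lambda>c :: real. to_fract [:c:]"
    by unfold_locales (simp_all add: one add mult)
  show ?thesis unfolding rat_mat_def by (rule mat_hom_mult[OF assms])
qed

text \<open>
  With \<open>F\<close> made of the rows of \<open>A\<close> at the nodes of \<open>S\<close>, subtracting the product below from
  \<open>A\<close> deletes exactly the arcs that enter \<open>S\<close>.
\<close>
lemma sel_cols_mult_rows:
  assumes "finite S" "A \<in> carrier_mat n n" "i < n" "j < n"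
  defines "F \<equiv> mat (card S) n (\<lambda>(l, k). A $$ (sorted_list_of_set S ! l, k))"
  shows "(sel_cols n S * F) $$ (j, i) = (if j \<in> S then A $$ (j, i) else 0)"
proof -
  let ?xs = "sorted_list_of_set S"
  have "(sel_cols n S * F) $$ (j, i) = (\<Sum>l<card S. sel_cols n S $$ (j, l) * F $$ (l, i))"
    using assms by (intro mult_mat_index_sum[OF sel_cols_carrier]) (simp_all add: F_def)
  also have "\<dots> = (\<Sum>l<card S. if j = ?xs ! l then A $$ (?xs ! l, i) else 0)"
    using assms by (intro sum.cong) (auto simp: sel_cols_index F_def)
  also have "\<dots> = (\<Sum>x\<in>S. if j = x then A $$ (x, i) else 0)"
    using bij_betw_nth[of ?xs "{..<card S}" S] assms(1)
    by (intro sum.reindex_bij_betw) simp_all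
  finally show ?thesis using assms(1) by simp
qed

text \<open>
  Multiplying by selection matrices on both sides extracts a submatrix of \<open>R\<close>, so a transfer
  matrix can be checked entry by entry on the resolvent.
\<close>
lemma sel_rows_mult_sel_cols_eq_0:
  assumes "finite S" "finite U" "R \<in> carrier_mat n n"
    and zero: "\<And>i j. i < n \<Longrightarrow> j < n \<Longrightarrow> i \<in> U \<Longrightarrow> j \<in> S \<Longrightarrow> R $$ (j, i) = 0"
  shows "rat_mat (sel_rows n S) * R * rat_mat (sel_cols n U) = 0\<^sub>m (card S) (card U)"
proof -
  let ?T = "rat_mat (sel_rows n S)" and ?D = "rat_mat (sel_cols n U)"
  have T: "?T \<in> carrier_mat (card S) n" and D: "?D \<in> carrier_mat n (card U)"
    using sel_rows_carrier sel_cols_carrier by (simp_all add: rat_mat_def)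
  have T0: "?T $$ (a, j) = 0" if "a < card S" "j < n" "j \<notin> S" for a j
    using that assms(1) nth_mem[of a "sorted_list_of_set S"] sel_rows_carrier[of n S]
    by (auto simp: rat_mat_def sel_rows_index)
  have D0: "?D $$ (i, b) = 0" if "b < card U" "i < n" "i \<notin> U" for i b
    using that assms(2) nth_mem[of b "sorted_list_of_set U"] sel_cols_carrier[of n U]
    by (auto simp: rat_mat_def sel_cols_index)
  show ?thesis
  proof (rule eq_matI)
    fix a b
    assume "a < dim_row (0\<^sub>m (card S) (card U) :: real poly fract mat)"
      and "b < dim_col (0\<^sub>m (card S) (card U) :: real poly fract mat)"
    then have ab: "a < card S" "b < card U" by simp_all
    have TR: "(?T * R) $$ (a, i) = (\<Sum>j<n. ?T $$ (a, j) * R $$ (j, i))" if "i < n" for i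
      by (rule mult_mat_index_sum[OF T assms(3) ab(1) that])
    have "(?T * R) $$ (a, i) = 0" if "i < n" "i \<in> U" for i
      unfolding TR[OF that(1)]
    proof (rule sum.neutral, rule ballI)
      fix j assume "j \<in> {..<n}"
      then show "?T $$ (a, j) * R $$ (j, i) = 0"
        using T0[OF ab(1), of j] zero[of i j] that by (cases "j \<in> S") auto
    qed
    then have "(?T * R) $$ (a, i) * ?D $$ (i, b) = 0" if "i < n" for i
      using that D0[OF ab(2), of i] by (cases "i \<in> U") auto
    then have "(\<Sum>i<n. (?T * R) $$ (a, i) * ?D $$ (i, b)) = 0" by (intro sum.neutral) simp
    moreover have "(?T * R * ?D) $$ (a, b) = (\<Sum>i<n. (?T * R) $$ (a, i) * ?D $$ (i, b))"
      by (rule mult_mat_index_sum[OF mult_carrier_mat[OF T assms(3)] D ab])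
    ultimately show "(?T * R * ?D) $$ (a, b) = 0\<^sub>m (card S) (card U) $$ (a, b)"
      using ab by simp
  qed (use T D in auto)
qed

text \<open>
  The hypothesis on \<open>Z\<close> is the structural form of controlled invariance: the state can leave
  \<open>Z\<close> only through nodes where an input acts, and there the input can cancel the flow.
\<close>
lemma DDPSF_solvable_if_controlled_invariant:
  assumes A: "A \<in> carrier_mat n n"
    and fin: "finite B" "finite D" "finite T"
    and Z: "D \<subseteq> Z" "Z \<inter> T = {}"
    and closed: "\<And>i j. i < n \<Longrightarrow> j < n \<Longrightarrow> i \<in> Z \<Longrightarrow> A $$ (j, i) \<noteq> 0 \<Longrightarrow> j \<in> Z \<union> B"
  shows "DDPSF_solvable A (sel_cols n B) (sel_cols n D) (sel_rows n T)"
proof -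
  define F where "F = mat (card B) n (\<lambda>(l, k). A $$ (sorted_list_of_set B ! l, k))"
  define N where "N = A - sel_cols n B * F"
  have F: "F \<in> carrier_mat (card B) n" by (simp add: F_def)
  have BF: "sel_cols n B * F \<in> carrier_mat n n"
    using sel_cols_carrier F by (rule mult_carrier_mat)
  then have N: "N \<in> carrier_mat n n" unfolding N_def by (rule minus_carrier_mat)
  have pencil:
    "rat_s \<cdot>\<^sub>m 1\<^sub>m n - rat_mat A + rat_mat (sel_cols n B) * rat_mat F = pencil N"
    unfolding rat_mat_mult[OF sel_cols_carrier F, symmetric] N_def
    using pencil_diff[OF A BF] A by simp
  have invariant: "N $$ (j, i) = 0" if "i < n" "j < n" "i \<in> Z" "j \<notin> Z" for i j
  proof -
    have "N $$ (j, i) = A $$ (j, i) - (sel_cols n B * F) $$ (j, i)"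
      unfolding N_def by (rule index_minus_mat(1)) (use BF that in auto)
    also have "(sel_cols n B * F) $$ (j, i) = (if j \<in> B then A $$ (j, i) else 0)"
      unfolding F_def by (rule sel_cols_mult_rows[OF fin(1) A that(1,2)])
    finally show ?thesis using that closed[of i j] by auto
  qed
  obtain R where R: "mat_inverse (pencil N) = Some R" "R \<in> carrier_mat n n" "pencil N * R = 1\<^sub>m n"
    using mat_inverse_pencil[OF N] .
  have "R $$ (j, i) = 0" if "i < n" "j < n" "i \<in> D" "j \<in> T" for i j
    by (rule resolvent_preserves_invariant_coordinates[where Z = Z, OF N R(2,3) invariant])
       (use that Z in auto)
  then have "rat_mat (sel_rows n T) * R * rat_mat (sel_cols n D) = 0\<^sub>m (card T) (card D)"
    by (intro sel_rows_mult_sel_cols_eq_0[OF fin(3,2) R(2)])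
  then show ?thesis
    unfolding DDPSF_solvable_def
    using R(1) F A sel_cols_carrier[of n B] sel_cols_carrier[of n D] sel_rows_carrier[of n T]
    by (intro bexI[of _ F] exI[of _ R]) (auto simp: pencil)
qed

theorem theorem2:
  fixes G :: "nat pair_pre_digraph" and n :: nat and A :: "real mat"
    and \<B> \<C> \<D> \<T> :: "nat set"
  assumes "weighted_digraph G n A"
    and "\<B> \<subseteq> pverts G" and "\<C> \<subseteq> pverts G" and "\<D> \<subseteq> pverts G" and "\<T> \<subseteq> pverts G"
    and "\<D> \<inter> \<T> = {}" and "\<D> \<inter> \<B> = {}" and "\<T> \<inter> \<C> = {}"
  shows "(\<D> \<subseteq> Z_lim G \<T> \<B> \<longleftrightarrow> (\<forall>p. DT_path G \<D> \<T> p \<longrightarrow> \<B> \<inter> set p \<noteq> {})) \<and>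
    (\<D> \<subseteq> Z_lim G \<T> \<B> \<or> (\<forall>p. DT_path G \<D> \<T> p \<longrightarrow> \<B> \<inter> set p \<noteq> {}) \<longrightarrow>
      DDPSF_solvable A (sel_cols n \<B>) (sel_cols n \<D>) (sel_rows n \<T>))"
proof -
  interpret weighted_digraph G n A by fact
  have fin: "finite (pverts G)" by (simp add: verts_eq)
  have wf: "parcs G \<subseteq> pverts G \<times> pverts G"
    using in_arcsD1 in_arcsD2 by auto
  have "\<B> \<inter> set p \<noteq> {}" if sub: "\<D> \<subseteq> Z_lim G \<T> \<B>" and p: "DT_path G \<D> \<T> p" for p
  proof (rule vwalk_leaving_meets_exit)
    show "vwalk p (with_proj G)" "hd p \<in> Z_lim G \<T> \<B>" "last p \<notin> Z_lim G \<T> \<B>"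
      using sub p Z_lim_subset[OF fin, of \<T> \<B>] by (auto simp: DT_path_def vpath_def)
  qed (rule Z_lim_closed[OF fin])
  moreover have "\<D> \<subseteq> Z_lim G \<T> \<B>" if "\<forall>p. DT_path G \<D> \<T> p \<longrightarrow> \<B> \<inter> set p \<noteq> {}"
    using that by (intro sources_in_Z_lim[OF fin wf assms(4,7)]) blast
  ultimately have equiv:
    "\<D> \<subseteq> Z_lim G \<T> \<B> \<longleftrightarrow> (\<forall>p. DT_path G \<D> \<T> p \<longrightarrow> \<B> \<inter> set p \<noteq> {})"
    by blast
  have "DDPSF_solvable A (sel_cols n \<B>) (sel_cols n \<D>) (sel_rows n \<T>)"
    if sub: "\<D> \<subseteq> Z_lim G \<T> \<B>"
  proof (rule DDPSF_solvable_if_controlled_invariant[OF A_carrier])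
    show "finite \<B>" "finite \<D>" "finite \<T>"
      using assms(2,4,5) fin by (simp_all add: finite_subset)
    show "Z_lim G \<T> \<B> \<inter> \<T> = {}" using Z_lim_subset[OF fin, of \<T> \<B>] by blast
    show "j \<in> Z_lim G \<T> \<B> \<union> \<B>"
      if "i < n" "j < n" "i \<in> Z_lim G \<T> \<B>" "A $$ (j, i) \<noteq> 0" for i j
      using that Z_lim_closed[OF fin] A_nonzero_iff by blast
  qed (rule sub)
  with equiv show ?thesis by blast
qed

end
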